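(* There exists an uncountable set of pairs $(a,b)$ of irrational real numbers, with $a>0$, such that $a^b$ is a rational number for every pair $(a,b)$ in the set.
   Context: For real $a>0$ and real $b$, $a^b=e^{b\ln a}$ denotes the usual real power. A set is countable if it has the same cardinality as the set of natural numbers; uncountable means infinite and not countable. *)

theory Defs
  imports Complex_Main "HOL-Library.Countable_Set"
begin

end

theory Submission
  imports Defs "HOL-Analysis.Continuum_Not_Denumerable"
begin

text \<open>
  The curve \<open>b \<mapsto> (2 powr (1 / b), b)\<close> for \<open>b > 0\<close> lies entirely in the level set \<open>a powr b = 2\<close>, so
  rationality of the power is automatic and only the irrationality of both coordinates can fail.
  Each coordinate determines the point on the curve, so each is rational for only countably many
  \<open>b\<close>. Removing these countably many exceptions from the uncountable interval \<open>(0, 1)\<close> leaves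
  uncountably many points.
\<close>

theorem theorem2p1:
  shows "\<exists>S :: (real \<times> real) set. uncountable S \<and>
    (\<forall>(a, b)\<in>S. a \<notin> \<rat> \<and> b \<notin> \<rat> \<and> a > 0 \<and> a powr b \<in> \<rat>)"
proof -
  \<comment> \<open>Solving \<open>2 powr (1 / b) = q\<close> for \<open>b\<close> gives \<open>b = 1 / log 2 q\<close>, which exhibits the exponents
    with a rational base as an image of \<open>\<rat>\<close>.\<close>
  define E :: "real set" where "E = \<rat> \<union> (\<lambda>q. 1 / log 2 q) ` \<rat>"
  define B where "B = {0<..<1} - E"
  define S where "S = (\<lambda>b. (2 powr (1 / b), b)) ` B"
  have "countable E"
    unfolding E_def using countable_rat by blast
  then have "uncountable B"
    unfolding B_def by (simp add: uncountable_minus_countable uncountable_open_interval)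
  moreover have "inj_on (\<lambda>b. (2 powr (1 / b), b)) B"
    by (rule inj_onI) simp
  ultimately have "uncountable S"
    unfolding S_def using countable_image_inj_on by blast
  moreover have "a \<notin> \<rat> \<and> b \<notin> \<rat> \<and> a > 0 \<and> a powr b \<in> \<rat>" if "(a, b) \<in> S" for a b
  proof -
    from that have a: "a = 2 powr (1 / b)" and "b > 0" and "b \<notin> E"
      by (auto simp: S_def B_def)
    have "b = 1 / log 2 a"
      by (simp add: a)
    with \<open>b \<notin> E\<close> have "a \<notin> \<rat>"
      unfolding E_def by blast
    moreover have "b \<notin> \<rat>"
      using \<open>b \<notin> E\<close> by (simp add: E_def)
    moreover have "a powr b = 2"
      using \<open>b > 0\<close> by (simp add: a powr_powr)
    ultimately show ?thesis
      by (simp add: a)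
  qed
  ultimately show ?thesis
    by blast
qed

end
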